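(* Let $\mathcal{M}=\{(n,m)\in\mathbb{N}\times\mathbb{N} : n>m,\ \gcd(n,m)=1,\ (-1)^{n+m}=-1\}$. The primitive $DS$-triples of the form $[c,c,d]$ or $[c,d,d]$ with $c<d$ are precisely the triples of the following two types, parametrized by $(n,m)\in\mathcal{M}$. Type I: $[(n-m)^2,(n-m)^2,2nm]$ if $n^2+m^2<4nm$, and $[2nm,(n-m)^2,(n-m)^2]$ if $n^2+m^2>4nm$. In both cases $q=n^2-m^2$, $c_{4,+}=2n(2n-m)$ and $c_{4,-}=2m(2m-n)$. Type II: $[2m^2,2m^2,n^2-m^2]$ if $\sqrt{3}\,m<n$, and $[n^2-m^2,2m^2,2m^2]$ if $\sqrt{3}\,m>n$. In both cases $q=2nm$, $c_{4,+}=(n+m)(n+3m)$ and $c_{4,-}=(n-m)(n-3m)$.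
   Context: $\mathbb{N}$ denotes the positive integers. For integers $0<c_1\le c_2\le c_3$ put $q=\sqrt{c_1c_2+c_1c_3+c_2c_3}>0$ and $c_{4,\pm}=c_1+c_2+c_3\pm 2q$. The triple $[c_1,c_2,c_3]$ is called a $DS$-triple (Descartes-Steiner triple) if both $c_{4,+}$ and $c_{4,-}$ are integers (equivalently, $q$ is an integer), and a primitive $DS$-triple if moreover $\gcd(c_1,c_2,c_3)=1$. *)

theory Defs
  imports Complex_Main
begin

type_synonym triple = "int \<times> int \<times> int"

fun q :: "triple \<Rightarrow> real" where
  "q (c\<^sub>1, c\<^sub>2, c\<^sub>3) = sqrt (of_int (c\<^sub>1 * c\<^sub>2 + c\<^sub>1 * c\<^sub>3 + c\<^sub>2 * c\<^sub>3))"

fun c4_plus :: "triple \<Rightarrow> real" where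
  "c4_plus (c\<^sub>1, c\<^sub>2, c\<^sub>3) = of_int (c\<^sub>1 + c\<^sub>2 + c\<^sub>3) + 2 * q (c\<^sub>1, c\<^sub>2, c\<^sub>3)"

fun c4_minus :: "triple \<Rightarrow> real" where
  "c4_minus (c\<^sub>1, c\<^sub>2, c\<^sub>3) = of_int (c\<^sub>1 + c\<^sub>2 + c\<^sub>3) - 2 * q (c\<^sub>1, c\<^sub>2, c\<^sub>3)"

fun DS_triple :: "triple \<Rightarrow> bool" where
  "DS_triple (c\<^sub>1, c\<^sub>2, c\<^sub>3) \<longleftrightarrow>
     0 < c\<^sub>1 \<and> c\<^sub>1 \<le> c\<^sub>2 \<and> c\<^sub>2 \<le> c\<^sub>3 \<and>
     c4_plus (c\<^sub>1, c\<^sub>2, c\<^sub>3) \<in> \<int> \<and> c4_minus (c\<^sub>1, c\<^sub>2, c\<^sub>3) \<in> \<int>"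

fun primitive_DS_triple :: "triple \<Rightarrow> bool" where
  "primitive_DS_triple (c\<^sub>1, c\<^sub>2, c\<^sub>3) \<longleftrightarrow>
     DS_triple (c\<^sub>1, c\<^sub>2, c\<^sub>3) \<and> gcd c\<^sub>1 (gcd c\<^sub>2 c\<^sub>3) = 1"

definition M :: "(nat \<times> nat) set" where
  "M = {(n, m). 0 < n \<and> 0 < m \<and> m < n \<and> gcd n m = 1 \<and> (-1::int) ^ (n + m) = -1}"

text \<open>The next two predicates say that \<open>t\<close> is the triple of the respective type with parameters
  \<open>(n, m)\<close>. For \<open>(n, m) \<in> M\<close> equality never holds in the comparison that selects the order
  of the entries.\<close>

definition type_I :: "nat \<Rightarrow> nat \<Rightarrow> triple \<Rightarrow> bool" where
  "type_I n m t \<longleftrightarrow>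
     n\<^sup>2 + m\<^sup>2 < 4 * n * m \<and> t = ((int n - int m)\<^sup>2, (int n - int m)\<^sup>2, 2 * int n * int m) \<or>
     n\<^sup>2 + m\<^sup>2 > 4 * n * m \<and> t = (2 * int n * int m, (int n - int m)\<^sup>2, (int n - int m)\<^sup>2)"

definition type_II :: "nat \<Rightarrow> nat \<Rightarrow> triple \<Rightarrow> bool" where
  "type_II n m t \<longleftrightarrow>
     sqrt 3 * real m < real n \<and> t = (2 * (int m)\<^sup>2, 2 * (int m)\<^sup>2, (int n)\<^sup>2 - (int m)\<^sup>2) \<or>
     sqrt 3 * real m > real n \<and> t = ((int n)\<^sup>2 - (int m)\<^sup>2, 2 * (int m)\<^sup>2, 2 * (int m)\<^sup>2)"

end

theory Submission
  imports Defs "HOL-Computational_Algebra.Nth_Powers"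
begin

text \<open>
  A triple of the form \<open>[c, c, d]\<close> or \<open>[c, d, d]\<close> consists of an entry \<open>x\<close> that occurs twice
  and a different entry \<open>y\<close>, and for both orders \<open>q\<^sup>2 = x (x + 2 y)\<close>, that is,
  \<open>q\<^sup>2 + y\<^sup>2 = (x + y)\<^sup>2\<close>. So the question is when \<open>x (x + 2 y)\<close> is a perfect square for coprime
  \<open>x\<close> and \<open>y\<close>. The common divisors of the two factors divide 2, so the parity of \<open>x\<close> decides:

  \<^item> If \<open>x\<close> is odd, the factors are coprime, hence are odd squares \<open>a\<^sup>2 < b\<^sup>2\<close>. The numbers
    \<open>n = (a + b) / 2\<close> and \<open>m = (b - a) / 2\<close> give \<open>x = (n - m)\<^sup>2\<close> and \<open>y = 2 n m\<close>: type I.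

  \<^item> If \<open>x = 2 u\<close> is even, then \<open>y\<close> is odd and \<open>u (u + y)\<close> is a square with coprime factors,
    so \<open>u = m\<^sup>2\<close> and \<open>u + y = n\<^sup>2\<close>: type II.

  The lemma \<open>double_entry_square_iff\<close> is this classification together with its converse. The
  conditions in the two types that compare \<open>n\<close> with \<open>m\<close> say just which of \<open>x\<close> and \<open>y\<close> is smaller,
  and the formulas for \<open>q\<close> and for the two solutions \<open>c\<^sub>4\<close> follow from \<open>q\<^sup>2 = x (x + 2 y)\<close>.
\<close>

section \<open>Coprime numbers with x (x + 2 y) a square\<close>

lemma coprime_int_product_square:
  fixes a b r :: int
  assumes "0 < a" "0 < b" "coprime a b" "a * b = r\<^sup>2"
  obtains s t :: nat where "a = (int s)\<^sup>2" "b = (int t)\<^sup>2" "0 < s" "0 < t"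
proof -
  have "coprime (nat a) (nat b)"
    using assms(1-3) by (simp add: coprime_int_iff[symmetric])
  moreover have "nat a * nat b = (nat \<bar>r\<bar>)\<^sup>2"
    using assms by (simp add: nat_mult_distrib[symmetric] nat_power_eq[symmetric])
  ultimately have "is_nth_power 2 (nat a)" "is_nth_power 2 (nat b)"
    using is_nth_power_mult_coprime_nat_iff[of "nat a" "nat b" 2]
    by (metis is_nth_powerI)+
  then obtain s t where st: "nat a = s\<^sup>2" "nat b = t\<^sup>2"
    by (auto elim!: is_nth_powerE)
  then have "a = (int s)\<^sup>2" "b = (int t)\<^sup>2"
    using assms(1,2) by (metis int_nat_eq less_le of_nat_power)+
  moreover from this have "0 < s" "0 < t"
    using assms(1,2) by (auto intro!: Nat.gr0I)
  ultimately show thesis using that by blast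
qed

lemma M_iff:
  "(n, m) \<in> M \<longleftrightarrow> 0 < m \<and> m < n \<and> coprime (int n) (int m) \<and> odd (int n - int m)"
proof -
  have "(-1::int) ^ (n + m) = -1 \<longleftrightarrow> odd (n + m)"
    by (cases "even (n + m)") simp_all
  then show ?thesis
    by (auto simp: M_def coprime_iff_gcd_eq_1)
qed

text \<open>Here \<open>x\<close> and \<open>x + 2 y\<close> are coprime, hence squares \<open>a\<^sup>2\<close> and \<open>b\<^sup>2\<close> with \<open>a\<close> and \<open>b\<close> odd;
  \<open>n\<close> and \<open>m\<close> solve \<open>n - m = a\<close> and \<open>n + m = b\<close>.\<close>

lemma double_entry_square_odd:
  fixes x y r :: int
  assumes pos: "0 < x" "0 < y" and cop: "coprime x y" and sq: "x * (x + 2 * y) = r\<^sup>2"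
    and "odd x"
  shows "\<exists>(n, m)\<in>M. x = (int n - int m)\<^sup>2 \<and> y = 2 * int n * int m"
proof -
  have "coprime x (2 * y)"
    using cop \<open>odd x\<close> by (simp add: coprime_commute)
  then have "coprime x (x + 2 * y)"
    by (metis add.commute coprime_iff_gcd_eq_1 gcd_add2)
  then obtain a b where ab: "x = (int a)\<^sup>2" "x + 2 * y = (int b)\<^sup>2" "0 < a" "0 < b"
    using coprime_int_product_square[of x "x + 2 * y" r] pos sq by auto
  have "(int a)\<^sup>2 < (int b)\<^sup>2" using ab pos by linarith
  then have "a < b" using power2_less_imp_less[of "int a" "int b"] by simp
  have "odd (int a)" using ab(1) \<open>odd x\<close> by simp
  moreover have "odd (int b)" using ab(2) \<open>odd x\<close>
    by (metis dvd_triv_left even_add even_power zero_less_numeral)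
  ultimately have "even (b - a)" using \<open>a < b\<close> by simp
  define m where "m = (b - a) div 2"
  define n where "n = a + m"
  have bm: "b = a + 2 * m" using \<open>even (b - a)\<close> \<open>a < b\<close> by (simp add: m_def)
  have nm: "int n - int m = int a" by (simp add: n_def)
  have y: "y = 2 * int n * int m"
    using ab(1,2) unfolding bm n_def by (simp add: power2_eq_square algebra_simps)
  have "coprime (int a) (int m)"
    using cop unfolding y ab(1) by simp
  then have "coprime (int n) (int m)"
    by (simp add: n_def coprime_iff_gcd_eq_1)
  then have "(n, m) \<in> M"
    using nm \<open>odd (int a)\<close> ab(3) \<open>a < b\<close> bm by (simp add: M_iff n_def)
  then show ?thesis using ab(1) y nm by force
qed

text \<open>Here the factors have the common divisor 2. Dividing the equation
  by 4 leaves \<open>u (u + y)\<close> with \<open>u = x / 2\<close>, to which coprimality applies again. The opposite parity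
  of \<open>n\<close> and \<open>m\<close> comes from \<open>y = n\<^sup>2 - m\<^sup>2\<close>, which is odd because \<open>x\<close> is even.\<close>

lemma double_entry_square_even:
  fixes x y r :: int
  assumes pos: "0 < x" "0 < y" and cop: "coprime x y" and sq: "x * (x + 2 * y) = r\<^sup>2"
    and "even x"
  shows "\<exists>(n, m)\<in>M. x = 2 * (int m)\<^sup>2 \<and> y = (int n)\<^sup>2 - (int m)\<^sup>2"
proof -
  from \<open>even x\<close> obtain u where u: "x = 2 * u" by blast
  have "even (r\<^sup>2)" using sq \<open>even x\<close> by (metis dvd_mult2)
  then obtain s where s: "r = 2 * s" by auto
  have us: "u * (u + y) = s\<^sup>2" using sq by (simp add: u s power2_eq_square algebra_simps)
  have "odd y" using cop \<open>even x\<close> by (metis coprime_common_divisor odd_one)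
  have "coprime u y" using cop by (simp add: u)
  then have "coprime u (u + y)"
    by (metis add.commute coprime_iff_gcd_eq_1 gcd_add2)
  then obtain m n where mn: "u = (int m)\<^sup>2" "u + y = (int n)\<^sup>2" "0 < m" "0 < n"
    using coprime_int_product_square[of u "u + y" s] pos us u by auto
  have "(int m)\<^sup>2 < (int n)\<^sup>2" using mn pos by linarith
  then have "m < n" using power2_less_imp_less[of "int m" "int n"] by simp
  have y: "y = (int n)\<^sup>2 - (int m)\<^sup>2" using mn by simp
  then have "odd (int n - int m)" using \<open>odd y\<close> by simp
  moreover have "coprime (int n) (int m)"
    using \<open>coprime u (u + y)\<close> unfolding mn(2) unfolding mn(1) by (simp add: coprime_commute)
  ultimately have "(n, m) \<in> M" using \<open>m < n\<close> mn(3) by (simp add: M_iff)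
  then show ?thesis using u mn(1) y by force
qed

lemma coprime_type_I_entries:
  assumes "(n, m) \<in> M"
  shows "coprime ((int n - int m)\<^sup>2) (2 * int n * int m)"
proof -
  have "coprime (int n) (int m)" "odd (int n - int m)" using assms by (simp_all add: M_iff)
  then have "coprime (int n - int m) (int m)"
    by (simp add: coprime_iff_gcd_eq_1 gcd_diff1)
  moreover have "coprime (int n - int m) (int n)"
    using \<open>coprime (int n) (int m)\<close>
    by (metis coprime_commute coprime_iff_gcd_eq_1 gcd_diff2 gcd.commute gcd_diff1)
  ultimately show ?thesis using \<open>odd (int n - int m)\<close>
    by (simp add: coprime_commute)
qed

lemma coprime_type_II_entries:
  assumes "(n, m) \<in> M"
  shows "coprime (2 * (int m)\<^sup>2) ((int n)\<^sup>2 - (int m)\<^sup>2)"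
proof -
  have "coprime (int n) (int m)" "odd (int n - int m)" using assms by (simp_all add: M_iff)
  then have "coprime ((int n)\<^sup>2) ((int m)\<^sup>2)" "odd ((int n)\<^sup>2 - (int m)\<^sup>2)" by simp_all
  moreover from this(1) have "coprime ((int n)\<^sup>2 - (int m)\<^sup>2) ((int m)\<^sup>2)"
    by (simp only: coprime_iff_gcd_eq_1 gcd_diff1)
  ultimately show ?thesis
    by (simp add: coprime_commute)
qed

lemma double_entry_square_type_I:
  fixes n m :: "'a::comm_ring_1"
  shows "(n - m)\<^sup>2 * ((n - m)\<^sup>2 + 2 * (2 * n * m)) = (n\<^sup>2 - m\<^sup>2)\<^sup>2"
  by (simp add: power2_eq_square algebra_simps)

lemma double_entry_square_type_II:
  fixes n m :: "'a::comm_ring_1"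
  shows "2 * m\<^sup>2 * (2 * m\<^sup>2 + 2 * (n\<^sup>2 - m\<^sup>2)) = (2 * n * m)\<^sup>2"
  by (simp add: power2_eq_square algebra_simps)

lemma double_entry_square_iff:
  fixes x y :: int
  shows "0 < x \<and> 0 < y \<and> coprime x y \<and> (\<exists>r. x * (x + 2 * y) = r\<^sup>2) \<longleftrightarrow>
    (\<exists>(n, m)\<in>M. x = (int n - int m)\<^sup>2 \<and> y = 2 * int n * int m \<or>
      x = 2 * (int m)\<^sup>2 \<and> y = (int n)\<^sup>2 - (int m)\<^sup>2)" (is "?L \<longleftrightarrow> ?R")
proof
  assume ?L
  then show ?R
    using double_entry_square_odd[of x y] double_entry_square_even[of x y] by fast
next
  assume ?R
  then obtain n m where nm: "(n, m) \<in> M" and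
    "x = (int n - int m)\<^sup>2 \<and> y = 2 * int n * int m \<or>
      x = 2 * (int m)\<^sup>2 \<and> y = (int n)\<^sup>2 - (int m)\<^sup>2" (is "?I \<or> ?II") by auto
  then consider ?I | ?II by blast
  then show ?L
  proof cases
    case 1
    then show ?thesis
      using nm coprime_type_I_entries[OF nm] double_entry_square_type_I[of "int n" "int m"]
      by (auto simp: M_iff)
  next
    case 2
    have "(int m)\<^sup>2 < (int n)\<^sup>2" using nm by (simp add: M_iff power_strict_mono)
    with 2 show ?thesis
      using nm coprime_type_II_entries[OF nm] double_entry_square_type_II[of "int m" "int n"]
      by (auto simp: M_iff)
  qed
qed

section \<open>Triples with a double entry\<close>

text \<open>Keeping the double entry \<open>x\<close> and the single entry \<open>y\<close> as arguments, in place of the smaller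
  and the larger one, lets both orders be treated at once: \<open>q\<close> is not symmetric in \<open>x\<close> and \<open>y\<close>.\<close>

definition sorted_double_entry :: "int \<Rightarrow> int \<Rightarrow> triple \<Rightarrow> bool" where
  "sorted_double_entry x y t \<longleftrightarrow> x < y \<and> t = (x, x, y) \<or> y < x \<and> t = (y, x, x)"

text \<open>The comparison in type I is \<open>(n - m)\<^sup>2 < 2 n m\<close> with \<open>2 n m\<close> added on both sides, and squaring the
  one in type II gives \<open>3 m\<^sup>2 < n\<^sup>2\<close>, that is, \<open>2 m\<^sup>2 < n\<^sup>2 - m\<^sup>2\<close>.\<close>

lemma type_I_iff:
  "type_I n m t \<longleftrightarrow> sorted_double_entry ((int n - int m)\<^sup>2) (2 * int n * int m) t"
proof -
  have "n\<^sup>2 + m\<^sup>2 < 4 * n * m \<longleftrightarrow> int (n\<^sup>2 + m\<^sup>2) < int (4 * n * m)"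
    and "n\<^sup>2 + m\<^sup>2 > 4 * n * m \<longleftrightarrow> int (n\<^sup>2 + m\<^sup>2) > int (4 * n * m)"
    by (simp_all only: of_nat_less_iff)
  then show ?thesis
    unfolding type_I_def sorted_double_entry_def
    by (simp add: power2_diff algebra_simps)
qed

lemma type_II_iff:
  "type_II n m t \<longleftrightarrow> sorted_double_entry (2 * (int m)\<^sup>2) ((int n)\<^sup>2 - (int m)\<^sup>2) t"
proof -
  have real_int: "real_of_int (3 * (int m)\<^sup>2) = (sqrt 3 * real m)\<^sup>2"
    "real_of_int ((int n)\<^sup>2) = (real n)\<^sup>2"
    by (simp_all add: power_mult_distrib)
  have "sqrt 3 * real m < real n \<longleftrightarrow> (sqrt 3 * real m)\<^sup>2 < (real n)\<^sup>2"
    "sqrt 3 * real m > real n \<longleftrightarrow> (sqrt 3 * real m)\<^sup>2 > (real n)\<^sup>2"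
    unfolding linorder_not_le[symmetric] by (simp_all del: linorder_not_le)
  then have "sqrt 3 * real m < real n \<longleftrightarrow> 3 * (int m)\<^sup>2 < (int n)\<^sup>2"
    "sqrt 3 * real m > real n \<longleftrightarrow> 3 * (int m)\<^sup>2 > (int n)\<^sup>2"
    unfolding real_int[symmetric] of_int_less_iff .
  then show ?thesis
    unfolding type_II_def sorted_double_entry_def by auto
qed

text \<open>Integrality of \<open>c\<^sub>4\<close> directly gives only that \<open>2 q\<close> is an integer; but its square is
  \<open>4 q\<^sup>2\<close> with \<open>q\<^sup>2\<close> an integer, so \<open>2 q\<close> is even.\<close>

lemma DS_triple_iff_square:
  "DS_triple (a, b, c) \<longleftrightarrow>
    0 < a \<and> a \<le> b \<and> b \<le> c \<and> (\<exists>r::int. a * b + a * c + b * c = r\<^sup>2)"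
proof -
  let ?N = "a * b + a * c + b * c"
  have "c4_plus (a, b, c) \<in> \<int> \<and> c4_minus (a, b, c) \<in> \<int> \<longleftrightarrow> (\<exists>r. ?N = r\<^sup>2)" (is "?L \<longleftrightarrow> ?R")
    if "0 < a" "a \<le> b" "b \<le> c"
  proof
    assume ?L
    then have "c4_plus (a, b, c) - of_int (a + b + c) \<in> \<int>" by (intro Ints_diff) auto
    then have "2 * sqrt (of_int ?N) \<in> \<int>" by simp
    then obtain k :: int where k: "2 * sqrt (of_int ?N) = of_int k" by (elim Ints_cases)
    have "?N \<ge> 0" using that by simp
    then have "(2 * sqrt (of_int ?N))\<^sup>2 = of_int (4 * ?N)"
      by (simp add: power_mult_distrib del: of_int_add of_int_mult) simp
    then have "real_of_int (4 * ?N) = of_int (k\<^sup>2)" by (simp only: k of_int_power)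
    then have "4 * ?N = k\<^sup>2" by (simp only: of_int_eq_iff)
    moreover from this have "even (k\<^sup>2)" by (metis dvd_mult2 even_numeral)
    then obtain r where "k = 2 * r" by auto
    ultimately have "?N = r\<^sup>2" by (simp add: power_mult_distrib)
    then show ?R by blast
  next
    assume ?R
    then obtain r where "?N = r\<^sup>2" by blast
    then have "q (a, b, c) = of_int \<bar>r\<bar>" by simp
    then show ?L by (simp del: q.simps)
  qed
  then show ?thesis by auto
qed

lemma primitive_DS_triple_sorted_double_entry:
  assumes "sorted_double_entry x y t"
  shows "primitive_DS_triple t \<longleftrightarrow>
    0 < x \<and> 0 < y \<and> coprime x y \<and> (\<exists>r. x * (x + 2 * y) = r\<^sup>2)"
proof -
  have "x * x + x * y + x * y = x * (x + 2 * y)" "y * x + y * x + x * x = x * (x + 2 * y)"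
    by algebra+
  moreover have "gcd x (gcd x y) = gcd x y" "gcd y (gcd x x) = gcd x y"
    by (simp_all add: gcd.commute gcd.left_commute)
  ultimately show ?thesis
    using assms unfolding sorted_double_entry_def
    by (auto simp: DS_triple_iff_square coprime_iff_gcd_eq_1 simp del: DS_triple.simps)
qed

lemma c4_sorted_double_entry:
  assumes "sorted_double_entry x y t" and "of_int (x * (x + 2 * y)) = s\<^sup>2" and "0 \<le> s"
  shows "q t = s"
    and "c4_plus t = of_int (2 * x + y) + 2 * s"
    and "c4_minus t = of_int (2 * x + y) - 2 * s"
proof -
  have "q t = sqrt (of_int (x * (x + 2 * y)))"
    using assms(1) by (auto simp: sorted_double_entry_def algebra_simps)
  also have "\<dots> = s" using assms(2,3) by simp
  finally show q: "q t = s" .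
  show "c4_plus t = of_int (2 * x + y) + 2 * s"
    and "c4_minus t = of_int (2 * x + y) - 2 * s"
    using assms(1) q by (auto simp: sorted_double_entry_def)
qed

section \<open>The two types\<close>

theorem proposition4:
  "(\<forall>t. primitive_DS_triple t \<and> (\<exists>c d. c < d \<and> (t = (c, c, d) \<or> t = (c, d, d)))
        \<longleftrightarrow> (\<exists>(n, m)\<in>M. type_I n m t \<or> type_II n m t))
   \<and> (\<forall>(n, m)\<in>M. \<forall>t. type_I n m t \<longrightarrow>
        q t = (real n)\<^sup>2 - (real m)\<^sup>2
        \<and> c4_plus t = 2 * real n * (2 * real n - real m)
        \<and> c4_minus t = 2 * real m * (2 * real m - real n))
   \<and> (\<forall>(n, m)\<in>M. \<forall>t. type_II n m t \<longrightarrow>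
        q t = 2 * real n * real m
        \<and> c4_plus t = (real n + real m) * (real n + 3 * real m)
        \<and> c4_minus t = (real n - real m) * (real n - 3 * real m))"
proof (intro conjI allI)
  fix t
  have "primitive_DS_triple t \<and> (\<exists>c d. c < d \<and> (t = (c, c, d) \<or> t = (c, d, d))) \<longleftrightarrow>
      (\<exists>x y. sorted_double_entry x y t \<and> primitive_DS_triple t)"
    unfolding sorted_double_entry_def by blast
  also have "\<dots> \<longleftrightarrow> (\<exists>x y. sorted_double_entry x y t \<and>
      (0 < x \<and> 0 < y \<and> coprime x y \<and> (\<exists>r. x * (x + 2 * y) = r\<^sup>2)))"
    using primitive_DS_triple_sorted_double_entry by blast
  also have "\<dots> \<longleftrightarrow> (\<exists>(n, m)\<in>M. type_I n m t \<or> type_II n m t)"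
    unfolding double_entry_square_iff type_I_iff type_II_iff by blast
  finally show "primitive_DS_triple t \<and> (\<exists>c d. c < d \<and> (t = (c, c, d) \<or> t = (c, d, d))) \<longleftrightarrow>
      (\<exists>(n, m)\<in>M. type_I n m t \<or> type_II n m t)" .
next
  show "\<forall>(n, m)\<in>M. \<forall>t. type_I n m t \<longrightarrow>
        q t = (real n)\<^sup>2 - (real m)\<^sup>2
        \<and> c4_plus t = 2 * real n * (2 * real n - real m)
        \<and> c4_minus t = 2 * real m * (2 * real m - real n)"
  proof (clarify, goal_cases)
    case (1 n m a b c)
    have sq: "of_int ((int n - int m)\<^sup>2 * ((int n - int m)\<^sup>2 + 2 * (2 * int n * int m)))
        = ((real n)\<^sup>2 - (real m)\<^sup>2)\<^sup>2"
      unfolding double_entry_square_type_I by simp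
    have nonneg: "0 \<le> (real n)\<^sup>2 - (real m)\<^sup>2" using 1(1) by (simp add: M_iff power_mono)
    show ?case
      using c4_sorted_double_entry[OF 1(2)[unfolded type_I_iff] sq nonneg]
      by (simp add: power2_eq_square algebra_simps
          del: q.simps c4_plus.simps c4_minus.simps)
  qed
next
  show "\<forall>(n, m)\<in>M. \<forall>t. type_II n m t \<longrightarrow>
        q t = 2 * real n * real m
        \<and> c4_plus t = (real n + real m) * (real n + 3 * real m)
        \<and> c4_minus t = (real n - real m) * (real n - 3 * real m)"
  proof (clarify, goal_cases)
    case (1 n m a b c)
    have sq: "of_int (2 * (int m)\<^sup>2 * (2 * (int m)\<^sup>2 + 2 * ((int n)\<^sup>2 - (int m)\<^sup>2)))
        = (2 * real n * real m)\<^sup>2"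
      unfolding double_entry_square_type_II by simp
    have nonneg: "0 \<le> 2 * real n * real m" by simp
    show ?case
      using c4_sorted_double_entry[OF 1(2)[unfolded type_II_iff] sq nonneg]
      by (simp add: power2_eq_square algebra_simps
          del: q.simps c4_plus.simps c4_minus.simps)
  qed
qed

end
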